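(* Let $\alpha>0$ and $0<\gamma<1$. Let $\mathcal{F}$ be a shift invariant family of subsets of $\mathbb{N}$ with the Ramsey property such that $g_{\alpha,\gamma}[\mathcal{F}]\subseteq\mathcal{F}$. If $A$ is an essential $\mathcal{F}$-set in $\mathbb{N}$, then $g_{\alpha,\gamma}[A]$ is an essential $\mathcal{F}$-set in $\mathbb{N}$.
   Context: $\mathbb{N}=\{1,2,3,\dots\}$. For $\alpha>0$ and $0<\gamma<1$, $g_{\alpha,\gamma}(n)=\lfloor \alpha n+\gamma\rfloor$ for $n\in\mathbb{N}$; for $A\subseteq\mathbb{N}$, $g_{\alpha,\gamma}[A]=\{g_{\alpha,\gamma}(n):n\in A\}\cap\mathbb{N}$ (a value $0$, which can occur for finitely many $n$ when $\alpha$ is small, is discarded), and for a collection $\mathcal{F}$ of subsets of $\mathbb{N}$, $g_{\alpha,\gamma}[\mathcal{F}]=\{g_{\alpha,\gamma}[A]:A\in\mathcal{F}\}$. A family (of subsets of $\mathbb{N}$) is a nonempty collection $\mathcal{F}\subseteq\mathcal{P}(\mathbb{N})\setminus\{\emptyset\}$ that is upward hereditary: $A\in\mathcal{F}$ and $A\subseteq B\subseteq\mathbb{N}$ imply $B\in\mathcal{F}$. $\mathcal{F}$ has the Ramsey property if whenever $A\in\mathcal{F}$ and $A=A_1\cup A_2$, some $A_i\in\mathcal{F}$ ($i\in\{1,2\}$). $\mathcal{F}$ is shift invariant if $s+E=\{s+t:t\in E\}\in\mathcal{F}$ for all $s\in\mathbb{N}$, $E\in\mathcal{F}$. $\beta\mathbb{N}$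 is the set of ultrafilters on $\mathbb{N}$ (Stone-Čech compactification of discrete $\mathbb{N}$) with the operation $A\in p+q\iff\{x\in\mathbb{N}:-x+A\in q\}\in p$, where $-x+A=\{y\in\mathbb{N}:x+y\in A\}$. For a family $\mathcal{F}$ with the Ramsey property, $\beta(\mathcal{F})=\{p\in\beta\mathbb{N}:p\subseteq\mathcal{F}\}$. When $\beta(\mathcal{F})$ is a subsemigroup of $\beta\mathbb{N}$ (which holds if $\mathcal{F}$ is shift invariant), $A\subseteq\mathbb{N}$ is an essential $\mathcal{F}$-set if $A\in p$ for some idempotent $p=p+p$ in $\beta(\mathcal{F})$. *)

theory Defs
  imports Complex_Main
begin

text \<open>Throughout, the natural numbers start at 1; subsets of them are sets of type
  \<^typ>\<open>nat set\<close> contained in the following set.\<close>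

abbreviation Npos :: "nat set" where
  "Npos \<equiv> {1..}"

definition gfun :: "real \<Rightarrow> real \<Rightarrow> nat \<Rightarrow> int" where
  "gfun \<alpha> \<gamma> n = \<lfloor>\<alpha> * real n + \<gamma>\<rfloor>"

text \<open>The value 0, which \<^const>\<open>gfun\<close> may take, is discarded; for positive parameters there
  are no negative values.\<close>

definition gset :: "real \<Rightarrow> real \<Rightarrow> nat set \<Rightarrow> nat set" where
  "gset \<alpha> \<gamma> A = {m \<in> Npos. \<exists>n\<in>A. int m = gfun \<alpha> \<gamma> n}"

definition gcoll :: "real \<Rightarrow> real \<Rightarrow> nat set set \<Rightarrow> nat set set" where
  "gcoll \<alpha> \<gamma> \<F> = gset \<alpha> \<gamma> ` \<F>"

definition is_family :: "nat set set \<Rightarrow> bool" where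
  "is_family \<F> \<longleftrightarrow>
     \<F> \<noteq> {} \<and> \<F> \<subseteq> Pow Npos - {{}} \<and>
     (\<forall>A B. A \<in> \<F> \<longrightarrow> A \<subseteq> B \<longrightarrow> B \<subseteq> Npos \<longrightarrow> B \<in> \<F>)"

definition ramsey_property :: "nat set set \<Rightarrow> bool" where
  "ramsey_property \<F> \<longleftrightarrow>
     (\<forall>A A1 A2. A \<in> \<F> \<longrightarrow> A = A1 \<union> A2 \<longrightarrow> A1 \<in> \<F> \<or> A2 \<in> \<F>)"

definition shift_invariant :: "nat set set \<Rightarrow> bool" where
  "shift_invariant \<F> \<longleftrightarrow> (\<forall>s\<in>Npos. \<forall>E\<in>\<F>. (\<lambda>t. s + t) ` E \<in> \<F>)"

definition beta_N :: "nat set set set" where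
  "beta_N = {p. p \<subseteq> Pow Npos \<and> Npos \<in> p \<and> {} \<notin> p \<and>
     (\<forall>A\<in>p. \<forall>B\<in>p. A \<inter> B \<in> p) \<and>
     (\<forall>A\<in>p. \<forall>B. A \<subseteq> B \<longrightarrow> B \<subseteq> Npos \<longrightarrow> B \<in> p) \<and>
     (\<forall>A. A \<subseteq> Npos \<longrightarrow> A \<in> p \<or> Npos - A \<in> p)}"

text \<open>The translate \<open>-x + A\<close>.\<close>

definition neg_shift :: "nat \<Rightarrow> nat set \<Rightarrow> nat set" where
  "neg_shift x A = {y \<in> Npos. x + y \<in> A}"

definition uf_plus :: "nat set set \<Rightarrow> nat set set \<Rightarrow> nat set set" where
  "uf_plus p q = {A. A \<subseteq> Npos \<and> {x \<in> Npos. neg_shift x A \<in> q} \<in> p}"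

definition beta_fam :: "nat set set \<Rightarrow> nat set set set" where
  "beta_fam \<F> = {p \<in> beta_N. p \<subseteq> \<F>}"

text \<open>This notion is intended for those \<open>\<F>\<close> for which \<^term>\<open>beta_fam \<F>\<close> is closed under
  \<^const>\<open>uf_plus\<close>; this holds whenever \<open>\<F>\<close> is a shift invariant family with the Ramsey
  property.\<close>

definition essential_set :: "nat set set \<Rightarrow> nat set \<Rightarrow> bool" where
  "essential_set \<F> A \<longleftrightarrow>
     A \<subseteq> Npos \<and> (\<exists>p \<in> beta_fam \<F>. uf_plus p p = p \<and> A \<in> p)"

end

theory Submission
  imports Defs
begin

text \<open>
  Let \<open>p\<close> be an idempotent in \<^term>\<open>beta_fam \<F>\<close> that contains \<open>A\<close>. The witness for
  \<^term>\<open>gset \<alpha> \<gamma> A\<close> is the image of \<open>p\<close> under \<^term>\<open>gfun \<alpha> \<gamma>\<close>. It lies in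
  \<^term>\<open>beta_fam \<F>\<close> because \<open>\<F>\<close> is upward hereditary and contains \<^term>\<open>gcoll \<alpha> \<gamma> \<F>\<close>. Everything
  else is the claim that it is idempotent.

  The function \<^term>\<open>gfun \<alpha> \<gamma>\<close> is not additive, but it is additive on a member of \<open>p\<close>, and for the
  image of an idempotent that is enough (\<open>image_idempotent\<close>). The reason for the partial additivity
  is that \<open>n \<mapsto> \<alpha> n\<close> is a homomorphism into the circle: it sends the idempotent \<open>p\<close> to an
  idempotent of the circle, that is, to 0. So for every \<open>\<delta> > 0\<close> the set of all \<open>n\<close> for which
  \<open>\<alpha> n\<close> is within \<open>\<delta>\<close> of an integer belongs to \<open>p\<close> (\<open>idempotent_near_integers\<close>). As \<open>\<gamma>\<close> lies
  strictly between 0 and 1, \<open>\<lfloor>\<alpha> n + \<gamma>\<rfloor>\<close> is the nearest integer to \<open>\<alpha> n\<close> for such \<open>n\<close> and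
  small \<open>\<delta>\<close>, and nearest integers add up as long as the errors are small. Finally, an idempotent of
  the positive integers contains no finite set (\<open>idempotent_contains_tails\<close>), so the discarded
  value 0 does not matter to the image.
\<close>

lemma beta_N_subset: "p \<in> beta_N \<Longrightarrow> X \<in> p \<Longrightarrow> X \<subseteq> Npos"
  and beta_N_Npos: "p \<in> beta_N \<Longrightarrow> Npos \<in> p"
  and beta_N_empty: "p \<in> beta_N \<Longrightarrow> {} \<notin> p"
  and beta_N_Int: "p \<in> beta_N \<Longrightarrow> X \<in> p \<Longrightarrow> Y \<in> p \<Longrightarrow> X \<inter> Y \<in> p"
  and beta_N_up: "p \<in> beta_N \<Longrightarrow> X \<in> p \<Longrightarrow> X \<subseteq> Y \<Longrightarrow> Y \<subseteq> Npos \<Longrightarrow> Y \<in> p"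
  and beta_N_Compl: "p \<in> beta_N \<Longrightarrow> X \<subseteq> Npos \<Longrightarrow> X \<notin> p \<Longrightarrow> Npos - X \<in> p"
proof -
  assume "p \<in> beta_N"
  then have "p \<subseteq> Pow Npos" "Npos \<in> p" "{} \<notin> p" "\<forall>X\<in>p. \<forall>Y\<in>p. X \<inter> Y \<in> p"
    "\<forall>X\<in>p. \<forall>Y. X \<subseteq> Y \<longrightarrow> Y \<subseteq> Npos \<longrightarrow> Y \<in> p"
    "\<forall>X. X \<subseteq> Npos \<longrightarrow> X \<in> p \<or> Npos - X \<in> p"
    unfolding beta_N_def mem_Collect_eq by - (elim conjE, assumption)+
  note * = this
  show "X \<in> p \<Longrightarrow> X \<subseteq> Npos" using *(1) by auto
  show "Npos \<in> p" by (fact *(2))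
  show "{} \<notin> p" by (fact *(3))
  show "X \<in> p \<Longrightarrow> Y \<in> p \<Longrightarrow> X \<inter> Y \<in> p" using *(4) by simp
  show "X \<in> p \<Longrightarrow> X \<subseteq> Y \<Longrightarrow> Y \<subseteq> Npos \<Longrightarrow> Y \<in> p" using *(5) by simp
  show "X \<subseteq> Npos \<Longrightarrow> X \<notin> p \<Longrightarrow> Npos - X \<in> p" using *(6) by blast
qed

lemma beta_N_cong_on:
  assumes "p \<in> beta_N" "D \<in> p" "X \<subseteq> Npos" "Y \<subseteq> Npos" "X \<inter> D = Y \<inter> D"
  shows "X \<in> p \<longleftrightarrow> Y \<in> p"
proof -
  have "Y \<in> p" if "X \<in> p" "X \<inter> D = Y \<inter> D" "Y \<subseteq> Npos" for X Y
    using beta_N_up[OF assms(1) beta_N_Int[OF assms(1) that(1) assms(2)]] that by blast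
  then show ?thesis using assms(3-5) by metis
qed

lemma beta_N_bounded_function_constant:
  fixes f :: "nat \<Rightarrow> nat"
  assumes p: "p \<in> beta_N" and bound: "\<And>n. n \<in> Npos \<Longrightarrow> f n < k"
  shows "\<exists>i. {n \<in> Npos. f n = i} \<in> p"
proof -
  have "\<exists>i. {n \<in> Npos. f n = i} \<in> p" if "{n \<in> Npos. f n < k} \<in> p" for k
    using that
  proof (induction k)
    case 0
    then show ?case using beta_N_empty[OF p] by simp
  next
    case (Suc k)
    show ?case
    proof (cases "{n \<in> Npos. f n = k} \<in> p")
      case False
      then have "Npos - {n \<in> Npos. f n = k} \<in> p"
        by (intro beta_N_Compl[OF p]) auto
      then have "(Npos - {n \<in> Npos. f n = k}) \<inter> {n \<in> Npos. f n < Suc k} \<in> p"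
        using Suc.prems beta_N_Int[OF p] by blast
      then have "{n \<in> Npos. f n < k} \<in> p"
        by (rule beta_N_up[OF p]) auto
      then show ?thesis by (rule Suc.IH)
    qed blast
  qed
  moreover have "{n \<in> Npos. f n < k} = Npos" using bound by auto
  ultimately show ?thesis using beta_N_Npos[OF p] by metis
qed

text \<open>If almost all numbers exceed \<open>M\<close>, then almost all sums of two positive numbers exceed
  \<open>M + 1\<close>; for an idempotent, almost all numbers are such sums.\<close>

lemma idempotent_contains_tails:
  assumes p: "p \<in> beta_N" and idem: "uf_plus p p = p"
  shows "{n \<in> Npos. M < n} \<in> p"
proof (induction M)
  case 0
  have "{n \<in> Npos. 0 < n} = Npos" by auto
  then show ?case using beta_N_Npos[OF p] by simp
next
  case (Suc M)
  have "neg_shift x {n \<in> Npos. Suc M < n} = Npos" if "M < x" for x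
    using that by (auto simp: neg_shift_def)
  then have "{x \<in> Npos. neg_shift x {n \<in> Npos. Suc M < n} \<in> p} \<in> p"
    using beta_N_Npos[OF p] by (intro beta_N_up[OF p Suc.IH]) auto
  then have "{n \<in> Npos. Suc M < n} \<in> uf_plus p p"
    by (auto simp: uf_plus_def)
  then show ?case by (simp only: idem)
qed

text \<open>Cut the circle into \<open>N\<close> arcs of length \<open>1 / N < \<delta>\<close>. One of them, \<open>C\<close>, captures \<open>\<alpha> n\<close> for
  \<open>p\<close>-almost all \<open>n\<close>. By idempotence there is a single \<open>x\<close> with \<open>\<alpha> x\<close> in \<open>C\<close> such that
  \<open>\<alpha> (x + y)\<close> is in \<open>C\<close> for \<open>p\<close>-almost all \<open>y\<close>; then \<open>\<alpha> y\<close>, the difference of two points of the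
  same arc, is close to an integer.\<close>

lemma idempotent_near_integers:
  fixes \<alpha> \<delta> :: real
  assumes p: "p \<in> beta_N" and idem: "uf_plus p p = p" and "\<delta> > 0"
  shows "{n \<in> Npos. \<exists>k::int. \<bar>\<alpha> * real n - of_int k\<bar> < \<delta>} \<in> p"
proof -
  obtain N :: nat where N: "N > 0" "1 / real N < \<delta>"
    using \<open>\<delta> > 0\<close> by (metis nat_approx_posE of_nat_Suc zero_less_Suc)
  define arc where "arc n = nat \<lfloor>real N * frac (\<alpha> * real n)\<rfloor>" for n
  have arc_bounds: "real (arc n) \<le> real N * frac (\<alpha> * real n)"
    "real N * frac (\<alpha> * real n) < real (arc n) + 1" for n
  proof -
    have "0 \<le> real N * frac (\<alpha> * real n)" by simp
    then show "real (arc n) \<le> real N * frac (\<alpha> * real n)"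
      "real N * frac (\<alpha> * real n) < real (arc n) + 1"
      unfolding arc_def by linarith+
  qed
  have "arc n < N" for n
  proof -
    have "real N * frac (\<alpha> * real n) < real N"
      using N(1) frac_lt_1[of "\<alpha> * real n"] by simp
    then show ?thesis using arc_bounds(1)[of n] by linarith
  qed
  then obtain i where C: "{n \<in> Npos. arc n = i} \<in> p" (is "?C \<in> p")
    using beta_N_bounded_function_constant[OF p] by blast
  then have "?C \<in> uf_plus p p" by (simp only: idem)
  then have "{x \<in> Npos. neg_shift x ?C \<in> p} \<in> p" by (simp add: uf_plus_def)
  then have "{x \<in> Npos. neg_shift x ?C \<in> p} \<inter> ?C \<in> p"
    using C beta_N_Int[OF p] by blast
  then have "{x \<in> Npos. neg_shift x ?C \<in> p} \<inter> ?C \<noteq> {}"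
    using beta_N_empty[OF p] by metis
  then obtain x where x: "arc x = i" "neg_shift x ?C \<in> p" by blast
  show ?thesis
  proof (rule beta_N_up[OF p x(2)])
    show "neg_shift x ?C \<subseteq> {n \<in> Npos. \<exists>k::int. \<bar>\<alpha> * real n - of_int k\<bar> < \<delta>}"
    proof
      fix y assume "y \<in> neg_shift x ?C"
      then have y: "y \<in> Npos" "arc (x + y) = i" by (auto simp: neg_shift_def)
      define d where "d = frac (\<alpha> * real (x + y)) - frac (\<alpha> * real x)"
      have "real N * \<bar>d\<bar> = \<bar>real N * frac (\<alpha> * real (x + y)) - real N * frac (\<alpha> * real x)\<bar>"
        unfolding d_def by (simp add: abs_mult flip: right_diff_distrib)
      also have "\<dots> < 1"
        using arc_bounds[of x] arc_bounds[of "x + y"] x(1) y(2) by linarith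
      finally have "\<bar>d\<bar> < 1 / real N" using N(1) by (simp add: field_simps)
      moreover have "\<alpha> * real y - of_int (\<lfloor>\<alpha> * real (x + y)\<rfloor> - \<lfloor>\<alpha> * real x\<rfloor>) = d"
        unfolding d_def frac_def by (simp add: algebra_simps)
      ultimately have "\<bar>\<alpha> * real y - of_int (\<lfloor>\<alpha> * real (x + y)\<rfloor> - \<lfloor>\<alpha> * real x\<rfloor>)\<bar> < \<delta>"
        using N(2) by linarith
      then show "y \<in> {n \<in> Npos. \<exists>k::int. \<bar>\<alpha> * real n - of_int k\<bar> < \<delta>}"
        using y(1) by blast
    qed
  qed auto
qed

definition uf_image :: "(nat \<Rightarrow> nat) \<Rightarrow> nat set set \<Rightarrow> nat set set" where
  "uf_image h p = {B. B \<subseteq> Npos \<and> {n \<in> Npos. h n \<in> B} \<in> p}"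

lemma uf_image_beta_N:
  assumes p: "p \<in> beta_N" and D: "D \<in> p" and pos: "\<And>n. n \<in> D \<Longrightarrow> h n \<in> Npos"
  shows "uf_image h p \<in> beta_N"
proof -
  have "{n \<in> Npos. h n \<in> Npos} \<in> p"
    using beta_N_subset[OF p D] pos by (intro beta_N_up[OF p D]) auto
  then have Npos: "Npos \<in> uf_image h p" by (simp add: uf_image_def)
  have Int: "X \<inter> Y \<in> uf_image h p" if "X \<in> uf_image h p" "Y \<in> uf_image h p" for X Y
  proof -
    have "{n \<in> Npos. h n \<in> X \<inter> Y} = {n \<in> Npos. h n \<in> X} \<inter> {n \<in> Npos. h n \<in> Y}" by auto
    then show ?thesis using that beta_N_Int[OF p] unfolding uf_image_def by auto
  qed
  have up: "Y \<in> uf_image h p" if "X \<in> uf_image h p" "X \<subseteq> Y" "Y \<subseteq> Npos" for X Y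
  proof -
    have "{n \<in> Npos. h n \<in> X} \<in> p" using that(1) by (simp add: uf_image_def)
    then have "{n \<in> Npos. h n \<in> Y} \<in> p"
      by (rule beta_N_up[OF p]) (use that(2) in auto)
    then show ?thesis using that(3) by (simp add: uf_image_def)
  qed
  have Compl: "Npos - X \<in> uf_image h p" if "X \<subseteq> Npos" "X \<notin> uf_image h p" for X
  proof -
    have "Npos - {n \<in> Npos. h n \<in> X} \<in> p"
      using that by (intro beta_N_Compl[OF p]) (auto simp: uf_image_def)
    then have "(Npos - {n \<in> Npos. h n \<in> X}) \<inter> D \<in> p"
      using D beta_N_Int[OF p] by blast
    then have "{n \<in> Npos. h n \<in> Npos - X} \<in> p"
      by (rule beta_N_up[OF p]) (use pos in auto)
    then show ?thesis by (simp add: uf_image_def)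
  qed
  have "{} \<notin> uf_image h p"
    using beta_N_empty[OF p] by (simp add: uf_image_def)
  moreover have "uf_image h p \<subseteq> Pow Npos" by (auto simp: uf_image_def)
  ultimately show ?thesis
    using Npos Int up Compl unfolding beta_N_def by blast
qed

text \<open>Both \<open>B \<in> h(p) + h(p)\<close> and \<open>B \<in> h(p + p)\<close> say that \<open>B\<close> contains a value for \<open>p\<close>-almost all
  \<open>m\<close> and, given \<open>m\<close>, for \<open>p\<close>-almost all \<open>n\<close>: the value \<open>h m + h n\<close> in the first case and
  \<open>h (m + n)\<close> in the second. These agree as soon as \<open>h\<close> is additive on pairs from a member
  \<open>D\<close> of \<open>p\<close>; the sums \<open>m + n\<close> themselves may lie outside \<open>D\<close>.\<close>

lemma image_idempotent:
  assumes p: "p \<in> beta_N" and idem: "uf_plus p p = p"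
    and D: "D \<in> p" and pos: "\<And>n. n \<in> D \<Longrightarrow> h n \<in> Npos"
    and add: "\<And>m n. m \<in> D \<Longrightarrow> n \<in> D \<Longrightarrow> h (m + n) = h m + h n"
  shows "uf_plus (uf_image h p) (uf_image h p) = uf_image h p"
proof -
  have DN: "D \<subseteq> Npos" by (rule beta_N_subset[OF p D])
  have "B \<in> uf_plus (uf_image h p) (uf_image h p) \<longleftrightarrow> B \<in> uf_image h p"
    if B: "B \<subseteq> Npos" for B
  proof -
    have inner: "neg_shift (h m) B \<in> uf_image h p \<longleftrightarrow> neg_shift m {n \<in> Npos. h n \<in> B} \<in> p"
      if m: "m \<in> D" for m
    proof -
      have "{n \<in> Npos. h n \<in> neg_shift (h m) B} \<in> p \<longleftrightarrow> neg_shift m {n \<in> Npos. h n \<in> B} \<in> p"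
        using m DN pos add
        by (intro beta_N_cong_on[OF p D]) (auto simp: neg_shift_def)
      then show ?thesis by (auto simp: uf_image_def neg_shift_def)
    qed
    have "B \<in> uf_plus (uf_image h p) (uf_image h p) \<longleftrightarrow>
        {m \<in> Npos. h m \<in> {x \<in> Npos. neg_shift x B \<in> uf_image h p}} \<in> p"
      using B by (auto simp: uf_plus_def uf_image_def)
    also have "\<dots> \<longleftrightarrow> {m \<in> Npos. neg_shift m {n \<in> Npos. h n \<in> B} \<in> p} \<in> p"
      using inner pos by (intro beta_N_cong_on[OF p D]) auto
    also have "\<dots> \<longleftrightarrow> {n \<in> Npos. h n \<in> B} \<in> uf_plus p p"
      by (auto simp: uf_plus_def)
    also have "\<dots> \<longleftrightarrow> B \<in> uf_image h p"
      using B by (simp add: idem uf_image_def)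
    finally show ?thesis .
  qed
  then show ?thesis by (auto simp: uf_plus_def uf_image_def)
qed

lemma gfun_eq_near_integer:
  assumes "\<bar>\<alpha> * real n - of_int k\<bar> < min \<gamma> (1 - \<gamma>)"
  shows "gfun \<alpha> \<gamma> n = k"
  unfolding gfun_def using assms by (intro floor_unique) linarith+

lemma gfun_add_near_integers:
  assumes "\<bar>\<alpha> * real m - of_int j\<bar> < min \<gamma> (1 - \<gamma>) / 2"
    and "\<bar>\<alpha> * real n - of_int k\<bar> < min \<gamma> (1 - \<gamma>) / 2"
  shows "gfun \<alpha> \<gamma> (m + n) = gfun \<alpha> \<gamma> m + gfun \<alpha> \<gamma> n"
proof -
  let ?r = "\<alpha> * real m - of_int j" and ?s = "\<alpha> * real n - of_int k"
  have "\<alpha> * real (m + n) - of_int (j + k) = ?r + ?s" by (simp add: distrib_left)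
  moreover have "\<bar>?r + ?s\<bar> < min \<gamma> (1 - \<gamma>)"
    using abs_triangle_ineq[of ?r ?s] add_strict_mono[OF assms] by simp
  ultimately have "gfun \<alpha> \<gamma> (m + n) = j + k"
    by (intro gfun_eq_near_integer) (simp only:)
  moreover have half: "x < c" if "x < c / 2" "0 \<le> x" for x c :: real
    using that by linarith
  have "gfun \<alpha> \<gamma> m = j" "gfun \<alpha> \<gamma> n = k"
    by (intro gfun_eq_near_integer half[OF assms(1)] half[OF assms(2)] abs_ge_zero)+
  ultimately show ?thesis by simp
qed

theorem corollary3p5:
  fixes \<alpha> \<gamma> :: real and \<F> :: "nat set set" and A :: "nat set"
  assumes "\<alpha> > 0" and "0 < \<gamma>" and "\<gamma> < 1"
    and "is_family \<F>" and "shift_invariant \<F>" and "ramsey_property \<F>"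
    and "gcoll \<alpha> \<gamma> \<F> \<subseteq> \<F>"
    and "essential_set \<F> A"
  shows "essential_set \<F> (gset \<alpha> \<gamma> A)"
proof -
  obtain p where p: "p \<in> beta_N" and pF: "p \<subseteq> \<F>" and idem: "uf_plus p p = p" and Ap: "A \<in> p"
    using assms(8) by (auto simp: essential_set_def beta_fam_def)
  define h where "h n = nat (gfun \<alpha> \<gamma> n)" for n
  \<comment> \<open>Half of the rounding tolerance: the errors of two summands add up.\<close>
  define \<delta> where "\<delta> = min \<gamma> (1 - \<gamma>) / 2"
  have "\<delta> > 0" using assms(2,3) by (simp add: \<delta>_def)
  \<comment> \<open>Beyond \<open>M\<close> the values of \<^term>\<open>gfun \<alpha> \<gamma>\<close> are positive.\<close>
  obtain M :: nat where M: "1 / \<alpha> < real M" using reals_Archimedean2 by blast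
  define D where
    "D = {n \<in> Npos. M < n} \<inter> {n \<in> Npos. \<exists>k::int. \<bar>\<alpha> * real n - of_int k\<bar> < \<delta>}"
  have D: "D \<in> p"
    unfolding D_def
    by (intro beta_N_Int[OF p] idempotent_contains_tails[OF p idem]
        idempotent_near_integers[OF p idem \<open>\<delta> > 0\<close>])
  have g_pos: "1 \<le> gfun \<alpha> \<gamma> n" if "n \<in> D" for n
  proof -
    have "1 / \<alpha> < real n" using that M by (auto simp: D_def)
    then have "1 < \<alpha> * real n" using assms(1) by (simp add: field_simps)
    then show ?thesis unfolding gfun_def using assms(2) by linarith
  qed
  have g_add: "gfun \<alpha> \<gamma> (m + n) = gfun \<alpha> \<gamma> m + gfun \<alpha> \<gamma> n" if "m \<in> D" "n \<in> D" for m n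
    using that gfun_add_near_integers unfolding D_def \<delta>_def by blast
  have pos: "h n \<in> Npos" if "n \<in> D" for n
    using g_pos[OF that] by (simp add: h_def)
  have add: "h (m + n) = h m + h n" if "m \<in> D" "n \<in> D" for m n
    using g_pos[OF that(1)] g_pos[OF that(2)] g_add[OF that] by (simp add: h_def nat_add_distrib)
  have gset_h: "gset \<alpha> \<gamma> X = Npos \<inter> h ` X" for X
    by (force simp: gset_def h_def)
  let ?q = "uf_image h p"
  have "?q \<subseteq> \<F>"
  proof
    fix B assume B: "B \<in> ?q"
    then have "{n \<in> Npos. h n \<in> B} \<in> \<F>" using pF by (auto simp: uf_image_def)
    then have "gset \<alpha> \<gamma> {n \<in> Npos. h n \<in> B} \<in> \<F>"
      using assms(7) by (auto simp: gcoll_def)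
    moreover have "gset \<alpha> \<gamma> {n \<in> Npos. h n \<in> B} \<subseteq> B" by (auto simp: gset_h)
    moreover have "B \<subseteq> Npos" using B by (simp add: uf_image_def)
    ultimately show "B \<in> \<F>" using assms(4) unfolding is_family_def by blast
  qed
  moreover have "?q \<in> beta_N" by (rule uf_image_beta_N[OF p D pos])
  moreover have "uf_plus ?q ?q = ?q" using image_idempotent[OF p idem D, of h] pos add by blast
  moreover have "gset \<alpha> \<gamma> A \<in> ?q"
  proof -
    have "A \<inter> D \<in> p" by (rule beta_N_Int[OF p Ap D])
    then have "{n \<in> Npos. h n \<in> gset \<alpha> \<gamma> A} \<in> p"
      by (rule beta_N_up[OF p]) (use pos beta_N_subset[OF p Ap] in \<open>auto simp: gset_h\<close>)
    then show ?thesis by (auto simp: uf_image_def gset_def)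
  qed
  moreover have "gset \<alpha> \<gamma> A \<subseteq> Npos" by (auto simp: gset_def)
  ultimately show ?thesis by (auto simp: essential_set_def beta_fam_def)
qed

end
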